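(* Let $\ell\ge 2$ be an integer and let $G$ be a finite simple triangle-free graph that contains no $5$-hole, no $7$-hole, and no odd hole of length at least $2\ell+3$. Then $\chi(G)\le 12\ell+8$.
   Context: A hole is an induced cycle of length at least $4$; a $k$-hole is a hole of length $k$; an odd hole is a hole of odd length. $\chi(G)$ denotes the chromatic number of $G$. *)

theory Defs
  imports "Graph_Theory.Graph_Theory"
begin

text \<open>
  Finite simple graphs are the loop-free finite symmetric digraphs without parallel arcs of
  locale \<open>graph\<close>: an undirected edge is a pair of opposite arcs, and \<open>u \<rightarrow>\<^bsub>G\<^esub> v\<close> is adjacency.
\<close>

definition triangle_free :: "('a, 'b) pre_digraph \<Rightarrow> bool" where
  "triangle_free G \<longleftrightarrow> \<not> (\<exists>u v w. u \<rightarrow>\<^bsub>G\<^esub> v \<and> v \<rightarrow>\<^bsub>G\<^esub> w \<and> w \<rightarrow>\<^bsub>G\<^esub> u)"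

text \<open>
  A cycle is a list of arcs, so its vertices are the tails of its arcs and its length is the
  length of the list. It is induced if each arc of \<open>G\<close> between two of its vertices is an arc
  of the cycle up to orientation. The library also counts going back and forth along one edge
  as a cycle (of length 2), which the length bound excludes.
\<close>

definition hole :: "('a, 'b) pre_digraph \<Rightarrow> 'b list \<Rightarrow> bool" where
  "hole G p \<longleftrightarrow> pre_digraph.cycle G p \<and> 4 \<le> length p \<and>
     (\<forall>a \<in> arcs G. tail G a \<in> tail G ` set p \<and> head G a \<in> tail G ` set p \<longrightarrow>
        (\<exists>b \<in> set p. arc_to_ends G b = (tail G a, head G a) \<or>
                     arc_to_ends G b = (head G a, tail G a)))"

definition has_hole :: "('a, 'b) pre_digraph \<Rightarrow> nat \<Rightarrow> bool" where
  "has_hole G k \<longleftrightarrow> (\<exists>p. hole G p \<and> length p = k)"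

definition proper_coloring :: "('a, 'b) pre_digraph \<Rightarrow> nat \<Rightarrow> ('a \<Rightarrow> nat) \<Rightarrow> bool" where
  "proper_coloring G k c \<longleftrightarrow>
     c ` verts G \<subseteq> {..<k} \<and> (\<forall>u v. u \<rightarrow>\<^bsub>G\<^esub> v \<longrightarrow> c u \<noteq> c v)"

text \<open>
  The minimum exists for finite loop-free graphs; otherwise the value of \<open>LEAST\<close> may be
  meaningless.
\<close>

definition chromatic_number :: "('a, 'b) pre_digraph \<Rightarrow> nat" where
  "chromatic_number G = (LEAST k. \<exists>c. proper_coloring G k c)"

end

theory Submission
  imports Defs
begin

text \<open>
  Closed walks of length 3, 5 and 7 do not exist, so every ball of radius 3 is bipartite. It
  suffices to colour each distance level with \<open>6l + 4\<close> colours, using disjoint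
  palettes for even and odd levels. Suppose that this fails for a component \<open>C\<close> of a
  level. Deleting balls of radius 3, two colours at a time, gives a long induced path that starts
  at a vertex \<open>q\<close> of the previous level, runs inside \<open>C\<close>, and can be
  continued to a parent of any of the surviving vertices. Since a path from such a parent back to
  \<open>q\<close> through the lower levels closes it to a long hole, all these paths have the
  same parity. One of the two parities occurs on a set of vertices of large chromatic number; any
  two parents of its vertices that are far apart are then joined by a path of even length through
  the lower levels. Take an edge \<open>aa'\<close> in this set with parents \<open>y, y'\<close>
  and grow a second long path from the neighbourhood of the path \<open>y a a' y'\<close> to a
  parent of a far vertex. As there are no pentagons, the two ways of entering it from
  \<open>y\<close> and from \<open>y'\<close> have lengths of different parity, so one of the two
  holes obtained is odd and long.
\<close>

section \<open>Induced paths and connected sets\<close>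

text \<open>The combinatorics works with a bare adjacency relation on a whole type and with vertex
  lists. Arcs return only where induced cycles are turned into holes.\<close>

locale sgraph =
  fixes E :: "'a \<Rightarrow> 'a \<Rightarrow> bool"
  assumes sym: "E x y \<Longrightarrow> E y x" and irrefl: "\<not> E x x"
begin

text \<open>Excluding \<open>[]\<close> makes \<open>hd\<close> and \<open>last\<close> genuine end
  vertices throughout.\<close>

primrec ipath :: "'a list \<Rightarrow> bool" where
  "ipath [] = False"
| "ipath (x # ys) = (ys = [] \<or>
     (ipath ys \<and> E x (hd ys) \<and> x \<notin> set ys \<and> (\<forall>y\<in>set ys. E x y \<longrightarrow> y = hd ys)))"

lemma ipath_append:
  "xs \<noteq> [] \<Longrightarrow> ys \<noteq> [] \<Longrightarrow> ipath (xs @ ys) \<longleftrightarrow> ipath xs \<and> ipath ys \<and> E (last xs) (hd ys) \<and>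
     set xs \<inter> set ys = {} \<and> (\<forall>x\<in>set xs. \<forall>y\<in>set ys. E x y \<longrightarrow> x = last xs \<and> y = hd ys)"
proof (induction xs)
  case (Cons x xs)
  show ?case
  proof (cases "xs = []")
    case True
    then show ?thesis using Cons.prems by auto
  next
    case False
    let ?C = "\<lambda>xs. ipath ys \<and> E (last xs) (hd ys) \<and> set xs \<inter> set ys = {} \<and>
      (\<forall>x\<in>set xs. \<forall>y\<in>set ys. E x y \<longrightarrow> x = last xs \<and> y = hd ys)"
    let ?D = "E x (hd xs) \<and> x \<notin> set xs \<and> (\<forall>y\<in>set xs. E x y \<longrightarrow> y = hd xs)"
    have l: "last xs \<in> set xs" "hd xs \<in> set xs" using False by auto
    have "ipath ((x # xs) @ ys) \<longleftrightarrow> (ipath xs \<and> ?C xs) \<and> ?D \<and> x \<notin> set ys \<and>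
        (\<forall>y\<in>set ys. E x y \<longrightarrow> y = hd xs)"
      using Cons False by auto
    also have "\<dots> \<longleftrightarrow> (ipath xs \<and> ?D) \<and> ?C (x # xs)"
    proof -
      have "?C xs \<and> x \<notin> set ys \<and> (\<forall>y\<in>set ys. E x y \<longrightarrow> y = hd xs) \<longleftrightarrow> ?C (x # xs)" if ?D
      proof -
        have "last (x # xs) = last xs" "x \<noteq> last xs" using False l that by auto
        then show ?thesis using l by (simp only: list.set) blast
      qed
      then show ?thesis by blast
    qed
    finally show ?thesis using False by simp
  qed
qed simp

lemma ipath_rev: "ipath xs \<Longrightarrow> ipath (rev xs)"
proof (induction xs)
  case (Cons x xs)
  show ?case
  proof (cases "xs = []")
    case False
    then have "hd xs = last (rev xs)" by (simp add: last_rev)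
    moreover have "E (hd xs) x" using False Cons.prems sym[of x "hd xs"] by simp
    moreover have "y = hd xs" if "y \<in> set xs" "E y x" for y
      using that False Cons.prems sym[of y x] by simp
    ultimately show ?thesis using False Cons by (simp add: ipath_append)
  qed simp
qed simp

lemma ipath_append1: "ipath (xs @ ys) \<Longrightarrow> xs \<noteq> [] \<Longrightarrow> ipath xs"
  by (cases "ys = []") (auto simp: ipath_append)

lemma ipath_append2: "ipath (xs @ ys) \<Longrightarrow> ys \<noteq> [] \<Longrightarrow> ipath ys"
  by (cases "xs = []") (auto simp: ipath_append)

definition ipath_in :: "'a set \<Rightarrow> 'a \<Rightarrow> 'a \<Rightarrow> 'a list \<Rightarrow> bool" where
  "ipath_in Z x y xs \<longleftrightarrow> ipath xs \<and> hd xs = x \<and> last xs = y \<and> set xs \<subseteq> Z"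

lemma ipath_in_nonempty: "ipath_in Z x y xs \<Longrightarrow> xs \<noteq> []"
  by (auto simp: ipath_in_def)

lemma ipath_in_mem: assumes "ipath_in Z x y xs" shows "x \<in> Z" "y \<in> Z"
proof -
  have "hd xs \<in> set xs" "last xs \<in> set xs" using ipath_in_nonempty[OF assms] by auto
  then show "x \<in> Z" "y \<in> Z" using assms by (auto simp: ipath_in_def)
qed

lemma ipath_in_mono: "ipath_in Z x y xs \<Longrightarrow> Z \<subseteq> Z' \<Longrightarrow> ipath_in Z' x y xs"
  by (auto simp: ipath_in_def)

lemma ipath_in_sym: "ipath_in Z x y xs \<Longrightarrow> ipath_in Z y x (rev xs)"
  using ipath_in_nonempty[of Z x y xs] by (auto simp: ipath_in_def ipath_rev hd_rev last_rev)

lemma ipath_in_refl: "x \<in> Z \<Longrightarrow> ipath_in Z x x [x]"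
  by (simp add: ipath_in_def)

text \<open>If w lies on the path, the suffix from w does. Otherwise w is attached at its last
  neighbour on the path and everything before that is dropped, which leaves no chord at w.\<close>

lemma ipath_in_step:
  assumes c: "ipath_in Z x y xs" and e: "E w x" and w: "w \<in> Z"
  shows "\<exists>ys. ipath_in Z w y ys"
proof (cases "w \<in> set xs")
  case True
  then obtain us vs where "xs = us @ w # vs" by (meson split_list)
  then show ?thesis using c by (intro exI[of _ "w # vs"]) (auto simp: ipath_in_def dest: ipath_append2)
next
  case False
  have ne: "xs \<noteq> []" using c by (rule ipath_in_nonempty)
  then have "\<exists>u\<in>set xs. E w u" using e c by (metis ipath_in_def hd_in_set)
  then obtain us u vs where s: "xs = us @ u # vs" "E w u" "\<forall>v\<in>set vs. \<not> E w v"
    using split_list_last_prop[of xs "E w"] by blast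
  then have "ipath (w # u # vs)" using False c
    by (auto simp: ipath_in_def dest!: ipath_append2[of us "u # vs"])
  then show ?thesis using s c w by (intro exI[of _ "w # u # vs"]) (auto simp: ipath_in_def)
qed

lemma ipath_in_trans:
  assumes "ipath_in Z x y xs" "ipath_in Z y z ys" shows "\<exists>zs. ipath_in Z x z zs"
  using assms(1)
proof (induction xs arbitrary: x)
  case Nil then show ?case by (simp add: ipath_in_def)
next
  case (Cons a xs)
  show ?case
  proof (cases "xs = []")
    case True
    then show ?thesis using Cons.prems assms(2) by (auto simp: ipath_in_def)
  next
    case False
    then have "ipath_in Z (hd xs) y xs" using Cons.prems by (auto simp: ipath_in_def)
    then obtain zs where "ipath_in Z (hd xs) z zs" using Cons.IH by blast
    moreover have "E a (hd xs)" "a = x" "x \<in> Z" using Cons.prems False by (auto simp: ipath_in_def)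
    ultimately show ?thesis using ipath_in_step by blast
  qed
qed

lemma ipath_in_first:
  assumes c: "ipath_in Z x y xs" and t: "set xs \<inter> T \<noteq> {}"
  obtains ys z where "ipath_in Z x z (ys @ [z])" "z \<in> T" "set ys \<inter> T = {}"
proof -
  obtain ys z zs where s: "xs = ys @ z # zs" "z \<in> T" "\<forall>v\<in>set ys. v \<notin> T"
    using t split_list_first_prop[of xs "\<lambda>v. v \<in> T"] by blast
  have "ipath ((ys @ [z]) @ zs)" using c s by (simp add: ipath_in_def)
  then have "ipath (ys @ [z])" by (rule ipath_append1) simp
  then have "ipath_in Z x z (ys @ [z])" using c s(1) by (cases ys) (auto simp: ipath_in_def)
  then show ?thesis using s that by blast
qed

section \<open>Connected sets and components\<close>

definition connected_set :: "'a set \<Rightarrow> bool" where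
  "connected_set Z \<longleftrightarrow> (\<forall>x\<in>Z. \<forall>y\<in>Z. \<exists>xs. ipath_in Z x y xs)"

definition component :: "'a set \<Rightarrow> 'a \<Rightarrow> 'a set" where
  "component Z x = {y. \<exists>xs. ipath_in Z x y xs}"

lemma component_subset: "component Z x \<subseteq> Z"
  by (auto simp: component_def dest: ipath_in_mem)

lemma component_self: "x \<in> Z \<Longrightarrow> x \<in> component Z x"
  by (auto simp: component_def intro: ipath_in_refl)

lemma component_eq: "y \<in> component Z x \<Longrightarrow> component Z y = component Z x"
proof -
  assume "y \<in> component Z x"
  then obtain xs where xs: "ipath_in Z x y xs" by (auto simp: component_def)
  then show ?thesis
    unfolding component_def using ipath_in_trans[OF xs] ipath_in_trans[OF ipath_in_sym[OF xs]] by blast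
qed

lemma component_adj: assumes "y \<in> component Z x" "E y w" "w \<in> Z" shows "w \<in> component Z x"
proof -
  obtain xs where "ipath_in Z x y xs" using assms(1) by (auto simp: component_def)
  then obtain ys where "ipath_in Z w x ys" using ipath_in_step[OF ipath_in_sym sym[OF assms(2)] assms(3)] by blast
  then show ?thesis unfolding component_def using ipath_in_sym by blast
qed

lemma ipath_in_component: assumes "ipath_in Z x y xs" shows "ipath_in (component Z x) x y xs"
proof -
  have "v \<in> component Z x" if v: "v \<in> set xs" for v
  proof -
    obtain ys where "ipath_in Z x v (ys @ [v])"
      using ipath_in_first[OF assms, of "{v}"] v by auto
    then show ?thesis by (auto simp: component_def)
  qed
  then show ?thesis using assms by (auto simp: ipath_in_def)
qed

lemma connected_set_component: "connected_set (component Z x)"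
  unfolding connected_set_def
proof (intro ballI)
  fix u v assume uv: "u \<in> component Z x" "v \<in> component Z x"
  then have "v \<in> component Z u" by (simp add: component_eq)
  then obtain xs where "ipath_in Z u v xs" by (auto simp: component_def)
  then show "\<exists>xs. ipath_in (component Z x) u v xs" using ipath_in_component[of Z u v xs] component_eq[OF uv(1)] by auto
qed

section \<open>Colourings of vertex sets\<close>

definition colorable :: "'a set \<Rightarrow> nat \<Rightarrow> bool" where
  "colorable S k \<longleftrightarrow> (\<exists>c. (\<forall>v\<in>S. c v < k) \<and> (\<forall>u\<in>S. \<forall>v\<in>S. E u v \<longrightarrow> c u \<noteq> c v))"

lemma colorable_mono: "colorable S k \<Longrightarrow> S' \<subseteq> S \<Longrightarrow> k \<le> k' \<Longrightarrow> colorable S' k'"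
  unfolding colorable_def by (meson order_less_le_trans subsetD)

lemma colorable_Un: assumes "colorable A a" "colorable B b" shows "colorable (A \<union> B) (a + b)"
proof -
  obtain c where c: "\<forall>v\<in>A. c v < a" "\<forall>u\<in>A. \<forall>v\<in>A. E u v \<longrightarrow> c u \<noteq> c v"
    using assms(1) by (auto simp: colorable_def)
  obtain d where d: "\<forall>v\<in>B. d v < b" "\<forall>u\<in>B. \<forall>v\<in>B. E u v \<longrightarrow> d u \<noteq> d v"
    using assms(2) by (auto simp: colorable_def)
  let ?f = "\<lambda>v. if v \<in> A then c v else a + d v"
  have "?f u \<noteq> ?f v" if "u \<in> A \<union> B" "v \<in> A \<union> B" "E u v" for u v
    using that c d by (cases "u \<in> A"; cases "v \<in> A") force+
  moreover have "\<forall>v\<in>A \<union> B. ?f v < a + b" using c d by auto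
  ultimately show ?thesis unfolding colorable_def by (intro exI[of _ ?f]) blast
qed

lemma not_colorable_Diff: "\<not> colorable S (a + b) \<Longrightarrow> colorable T b \<Longrightarrow> \<not> colorable (S - T) a"
  using colorable_Un[of "S - T" a T b] colorable_mono[of "S - T \<union> T" "a + b" S "a + b"] by blast

lemma colorable_components: assumes "S \<subseteq> Z" "\<And>x. x \<in> S \<Longrightarrow> colorable (component Z x \<inter> S) k" shows "colorable S k"
proof -
  define P where "P = (\<lambda>X (c :: 'a \<Rightarrow> nat). (\<forall>v\<in>X. c v < k) \<and> (\<forall>u\<in>X. \<forall>v\<in>X. E u v \<longrightarrow> c u \<noteq> c v))"
  \<comment> \<open>The colouring is chosen per component as a set, not per vertex, so two vertices
    of one component are coloured by the same function.\<close>
  define F where "F = (\<lambda>X. SOME c. P (X \<inter> S) c)"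
  have F: "P (component Z x \<inter> S) (F (component Z x))" if "x \<in> S" for x
  proof -
    have "\<exists>c. P (component Z x \<inter> S) c" using assms(2)[OF that] by (simp add: colorable_def P_def)
    then show ?thesis unfolding F_def by (rule someI_ex)
  qed
  have "F (component Z u) u \<noteq> F (component Z v) v" if "u \<in> S" "v \<in> S" "E u v" for u v
  proof -
    have "v \<in> component Z u" using component_adj[OF component_self] that assms(1) by blast
    moreover from this have "component Z v = component Z u" by (rule component_eq)
    moreover have "u \<in> component Z u" using that(1) assms(1) component_self by blast
    ultimately show ?thesis using F[OF that(1)] that unfolding P_def by simp
  qed
  moreover have "F (component Z v) v < k" if "v \<in> S" for v
    using F[OF that] that component_self[of v Z] assms(1) unfolding P_def by blast
  ultimately show ?thesis unfolding colorable_def by (intro exI[of _ "\<lambda>v. F (component Z v) v"]) blast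
qed

lemma colorable_stable: "(\<And>u v. u \<in> S \<Longrightarrow> v \<in> S \<Longrightarrow> \<not> E u v) \<Longrightarrow> colorable S 1"
  unfolding colorable_def by (intro exI[of _ "\<lambda>_. 0"]) auto

text \<open>Some component Z of K - B carries a part of W that needs more than c colours. A path
  inside K from Z to B first leaves Z at a vertex w; were w outside B, it would belong to the
  component Z itself.\<close>

lemma cut_component:
  assumes K: "connected_set K" and B: "B \<subseteq> K" "B \<noteq> {}" and W: "W \<subseteq> K - B" "\<not> colorable W c"
  obtains Z w z where "connected_set Z" "Z \<subseteq> K - B" "w \<in> B" "z \<in> Z" "E w z" "\<not> colorable (W \<inter> Z) c"
proof -
  obtain x where x: "x \<in> W" "\<not> colorable (component (K - B) x \<inter> W) c"
    using colorable_components[of W "K - B" c] W by blast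
  define Z where "Z = component (K - B) x"
  obtain b where b: "b \<in> B" using B by auto
  have xZ: "x \<in> Z" unfolding Z_def using x W by (auto intro: component_self)
  have ZK: "Z \<subseteq> K - B" unfolding Z_def by (rule component_subset)
  have "x \<in> K" "b \<in> K" using x W B b by auto
  then obtain xs where xs: "ipath_in K x b xs" using K unfolding connected_set_def by blast
  have "b \<in> set xs" using last_in_set[OF ipath_in_nonempty[OF xs]] xs by (simp add: ipath_in_def)
  moreover have "b \<notin> Z" using b ZK by blast
  ultimately have "set xs \<inter> - Z \<noteq> {}" by blast
  then obtain ys w where y: "ipath_in K x w (ys @ [w])" "w \<in> - Z" "set ys \<inter> - Z = {}"
    by (rule ipath_in_first[OF xs])
  have ne: "ys \<noteq> []" using y xZ by (auto simp: ipath_in_def)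
  then have e: "E (last ys) w" using y by (auto simp: ipath_in_def ipath_append)
  have lZ: "last ys \<in> Z" using y last_in_set[OF ne] by blast
  have "w \<in> B"
  proof (rule ccontr)
    assume "w \<notin> B"
    then have "w \<in> K - B" using y by (auto simp: ipath_in_def)
    then have "w \<in> Z" using component_adj[OF lZ[unfolded Z_def] e] unfolding Z_def by blast
    then show False using y by auto
  qed
  moreover have "connected_set Z" unfolding Z_def by (rule connected_set_component)
  moreover have "\<not> colorable (W \<inter> Z) c" using x unfolding Z_def by (simp add: Int_commute)
  ultimately show ?thesis using that ZK lZ sym[OF e] by blast
qed

section \<open>Balls and distance levels\<close>

primrec ball :: "nat \<Rightarrow> 'a \<Rightarrow> 'a set" where
  "ball 0 u = {u}"
| "ball (Suc n) u = ball n u \<union> {w. \<exists>v\<in>ball n u. E v w}"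

lemma ball_adj: "v \<in> ball n u \<Longrightarrow> E v w \<Longrightarrow> w \<in> ball (Suc n) u"
  by auto

definition depth :: "'a \<Rightarrow> 'a \<Rightarrow> nat" where
  "depth z v = (LEAST n. v \<in> ball n z)"

text \<open>Membership in the ball guards against the arbitrary value of \<open>LEAST\<close> in
  \<open>depth\<close> at vertices that z does not reach.\<close>

definition level :: "'a \<Rightarrow> nat \<Rightarrow> 'a set" where
  "level z k = {v. v \<in> ball k z \<and> depth z v = k}"

lemma depth_le: "v \<in> ball n z \<Longrightarrow> depth z v \<le> n"
  unfolding depth_def by (rule Least_le)

lemma level_depth: "v \<in> ball n z \<Longrightarrow> v \<in> level z (depth z v)"
  unfolding level_def depth_def by (auto intro: LeastI)

lemma level_0: "level z 0 = {z}"
  unfolding level_def using depth_le[of z 0 z] by auto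

lemma level_adj: "v \<in> level z i \<Longrightarrow> w \<in> level z j \<Longrightarrow> E v w \<Longrightarrow> i \<le> Suc j \<and> j \<le> Suc i"
  unfolding level_def using depth_le[OF ball_adj[of v i z w]] depth_le[OF ball_adj[of w j z v]] sym[of v w]
  by simp

lemma level_inj: "v \<in> level z i \<Longrightarrow> v \<in> level z j \<Longrightarrow> i = j"
  by (auto simp: level_def)

lemma level_parent: assumes "v \<in> level z (Suc k)" obtains p where "p \<in> level z k" "E p v"
proof -
  have "v \<notin> ball k z" using assms depth_le[of v k z] by (auto simp: level_def)
  then obtain p where p: "p \<in> ball k z" "E p v" using assms by (auto simp: level_def)
  have "k \<le> depth z p" using level_adj[OF level_depth[OF p(1)] assms p(2)] by simp
  then have "p \<in> level z k" using p(1) depth_le[OF p(1)] by (simp add: level_def)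
  then show ?thesis using p that by blast
qed

lemma ipath_in_root:
  assumes "v \<in> level z k" "v \<in> Z" "\<And>j. j < k \<Longrightarrow> level z j \<subseteq> Z" shows "\<exists>xs. ipath_in Z v z xs"
  using assms
proof (induction k arbitrary: v)
  case 0
  then show ?case using ipath_in_refl by (auto simp: level_0)
next
  case (Suc k)
  obtain p where p: "p \<in> level z k" "E p v" using level_parent Suc.prems(1) by blast
  moreover have "p \<in> Z" using Suc.prems(3)[of k] p by auto
  moreover have "\<And>j. j < k \<Longrightarrow> level z j \<subseteq> Z" using Suc.prems(3) by simp
  ultimately obtain xs where "ipath_in Z p z xs" using Suc.IH by blast
  then show ?case using ipath_in_step sym[OF p(2)] Suc.prems(2) by blast
qed

section \<open>Induced cycles\<close>

definition icycle :: "'a list \<Rightarrow> bool" where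
  "icycle xs \<longleftrightarrow> 4 \<le> length xs \<and> ipath (tl xs) \<and> hd xs \<notin> set (tl xs) \<and>
     (\<forall>x\<in>set (tl xs). E (hd xs) x \<longleftrightarrow> x = hd (tl xs) \<or> x = last (tl xs))"

text \<open>Two induced paths with common ends close up to an induced cycle. Edges from the ends of
  M to I are controlled by the second path being induced, so the last assumption only has to rule
  out edges at inner vertices of M. The vertex \<open>hd M\<close> becomes the distinguished vertex
  of \<open>icycle\<close>.\<close>

lemma icycle_glue:
  assumes M: "ipath M" and U: "ipath (last M # I @ [hd M])" "I \<noteq> []"
    and len: "2 \<le> length M" "4 \<le> length M + length I"
    and dis: "set I \<inter> set M = {}"
    and adj: "\<And>x i. x \<in> set M \<Longrightarrow> i \<in> set I \<Longrightarrow> E x i \<Longrightarrow> x = hd M \<or> x = last M"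
  shows "icycle (M @ I)"
proof -
  obtain u M' where Mu: "M = u # M'" "M' \<noteq> []" using len by (cases M) (auto simp: Suc_le_eq)
  let ?v = "last M'"
  have v: "last M = ?v" "?v \<in> set M'" using Mu by auto
  have uv: "u \<noteq> ?v" "ipath M'" "E u (hd M')" "u \<notin> set M'" "\<forall>y\<in>set M'. E u y \<longrightarrow> y = hd M'"
    using M Mu v by auto
  have I1: "ipath ((?v # I) @ [u])" using U v Mu by simp
  then have I2: "ipath (?v # I)" by (rule ipath_append1) simp
  have I3: "\<forall>x\<in>set I. E u x \<longrightarrow> x = last I" "E u (last I)"
    using I1 U(2) sym by (auto simp: ipath_append)
  have I4: "ipath I" "E ?v (hd I)" "\<forall>y\<in>set I. E ?v y \<longrightarrow> y = hd I" using I2 U(2) by auto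
  have "x = ?v \<and> i = hd I" if "x \<in> set M'" "i \<in> set I" "E x i" for x i
    using adj[of x i] that uv(4) I4(3) v(1) Mu(1) by auto
  then have "ipath (M' @ I)"
    using uv(2) I4 dis Mu by (auto simp: ipath_append[OF Mu(2) U(2)])
  moreover have "\<forall>x\<in>set (M' @ I). E u x \<longleftrightarrow> x = hd (M' @ I) \<or> x = last (M' @ I)"
  proof
    fix x assume x: "x \<in> set (M' @ I)"
    show "E u x \<longleftrightarrow> x = hd (M' @ I) \<or> x = last (M' @ I)"
      using x uv I3 U(2) Mu by auto
  qed
  ultimately show ?thesis using len Mu uv dis by (auto simp: icycle_def)
qed

lemma ball3_step: "E u a \<Longrightarrow> a \<in> ball 3 u" "E u a \<Longrightarrow> E a b \<Longrightarrow> b \<in> ball 3 u"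
  "E u a \<Longrightarrow> E a b \<Longrightarrow> E b c \<Longrightarrow> c \<in> ball 3 u"
  by (auto simp: numeral_3_eq_3)

section \<open>Growing long induced paths\<close>

declare ipath.simps(2) [simp del]

lemma ipath_single [simp]: "ipath [x]"
  by (simp add: ipath.simps)

lemma ipath_ConsI:
  assumes "ipath ys" "E x (hd ys)" "x \<notin> set ys" "\<And>y. y \<in> set (tl ys) \<Longrightarrow> \<not> E x y"
  shows "ipath (x # ys)"
  using assms by (cases ys) (auto simp: ipath.simps)

lemma ipath_notin: "ipath (x # ys) \<Longrightarrow> x \<notin> set ys"
  by (auto simp: ipath.simps)

lemma ipath_far_apart:
  assumes p: "ipath (P @ M @ Q)" and ne: "P \<noteq> []" "M \<noteq> []" "Q \<noteq> []" and xy: "x \<in> set P" "y \<in> set Q"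
  shows "x \<noteq> y" "\<not> E x y"
proof -
  have a: "ipath (M @ Q)" "set P \<inter> set (M @ Q) = {}"
    "\<forall>x\<in>set P. \<forall>y\<in>set (M @ Q). E x y \<longrightarrow> y = hd M"
    using p ne ipath_append[of P "M @ Q"] by auto
  then have "set M \<inter> set Q = {}" using ne ipath_append[of M Q] by blast
  moreover have "hd M \<in> set M" using ne by simp
  ultimately have "hd M \<notin> set Q" by blast
  then show "x \<noteq> y" "\<not> E x y" using a xy by auto
qed

text \<open>A round of the induction passes to a component of \<open>Z\<close> without the ball of radius
  two around the root, moves the root next to it, and discards from \<open>W\<close> only a ball of radius 3:
  two path vertices are bought with two colours.\<close>

lemma grow:
  assumes col3: "\<And>u. colorable (ball 3 u) 2"
    and "connected_set Z" "x \<notin> Z" "z \<in> Z" "E x z" "W \<subseteq> Z" "W \<inter> ball 3 x = {}" "\<not> colorable W (c + 2 * n)"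
  shows "\<exists>W'\<subseteq>W. \<not> colorable W' c \<and> (\<forall>v\<in>W'. \<forall>y. y \<notin> insert x Z \<longrightarrow> E v y \<longrightarrow>
    (\<exists>R. ipath (x # R @ [y]) \<and> set R \<subseteq> Z \<and> 2 * n + 1 \<le> length R))"
  using assms(2-)
proof (induction n arbitrary: Z x z W)
  case 0
  have "\<exists>R. ipath (x # R @ [y]) \<and> set R \<subseteq> Z \<and> 1 \<le> length R"
    if v: "v \<in> W" and y: "y \<notin> insert x Z" "E v y" for v y
  proof -
    \<comment> \<open>The path from x is stopped at its first neighbour of y; appending y then keeps
      it induced. It has an inner vertex because v lies outside the ball around x, so x itself is
      not adjacent to y.\<close>
    let ?T = "{u. E u y}"
    have xy: "\<not> E x y" using ball3_step(2)[of x y v] sym[OF y(2)] v 0 by blast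
    obtain xs where "ipath_in Z z v xs" using 0 v unfolding connected_set_def by blast
    then have "ipath_in (insert x Z) z v xs" by (rule ipath_in_mono) blast
    then obtain xs where xs: "ipath_in (insert x Z) x v xs" using ipath_in_step 0(4) by blast
    have "v \<in> set xs" using last_in_set[OF ipath_in_nonempty[OF xs]] xs by (simp add: ipath_in_def)
    then have "set xs \<inter> ?T \<noteq> {}" using y by blast
    then obtain ys t where t: "ipath_in (insert x Z) x t (ys @ [t])" "t \<in> ?T" "set ys \<inter> ?T = {}"
      by (rule ipath_in_first[OF xs])
    have "ys \<noteq> []" using t xy by (auto simp: ipath_in_def)
    then obtain R where R: "ys = x # R" using t(1) by (cases ys) (auto simp: ipath_in_def)
    have "ipath ((ys @ [t]) @ [y])"
      using t y by (subst ipath_append) (auto simp: ipath_in_def)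
    moreover have "set (R @ [t]) \<subseteq> Z"
    proof -
      have i: "ipath (x # (R @ [t]))" "set (R @ [t]) \<subseteq> insert x Z" using t(1) R by (auto simp: ipath_in_def)
      then show ?thesis using ipath_notin[OF i(1)] by blast
    qed
    ultimately show ?thesis using R by (intro exI[of _ "R @ [t]"]) simp
  qed
  then show ?case using 0 by (intro exI[of _ W]) simp
next
  case (Suc n)
  define N where "N = {u \<in> Z. E x u}"
  define B where "B = N \<union> {u \<in> Z. \<exists>m\<in>N. E m u}"
  have B: "B \<subseteq> Z" "B \<noteq> {}" using Suc.prems by (auto simp: B_def N_def)
  have "B \<subseteq> ball 3 x" using ball3_step[of x] by (auto simp: B_def N_def)
  then have WB: "W \<subseteq> Z - B" using Suc.prems by blast
  have "\<not> colorable W (c + 2 * n + 2)" using Suc.prems by simp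
  from cut_component[OF Suc.prems(1) B WB this] obtain Z0 w z0
    where Z0: "connected_set Z0" "Z0 \<subseteq> Z - B" "w \<in> B" "z0 \<in> Z0" "E w z0" "\<not> colorable (W \<inter> Z0) (c + 2 * n + 2)" .
  \<comment> \<open>Neighbours in Z of a vertex of N lie in B, but w has a neighbour in Z0, which
    avoids B. So w is at distance two from x, and m is the vertex between them.\<close>
  have "w \<notin> N" using Z0 unfolding B_def by blast
  then obtain m where m: "m \<in> N" "E m w" "w \<in> Z" using Z0(3) unfolding B_def by blast
  have xw: "\<not> E x w" using \<open>w \<notin> N\<close> m by (simp add: N_def)
  have "\<not> colorable (W \<inter> Z0 - ball 3 w) (c + 2 * n)" using Z0(6) col3 by (rule not_colorable_Diff)
  then obtain W' where W': "W' \<subseteq> W \<inter> Z0 - ball 3 w" "\<not> colorable W' c"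
    "\<forall>v\<in>W'. \<forall>y. y \<notin> insert w Z0 \<longrightarrow> E v y \<longrightarrow>
      (\<exists>R. ipath (w # R @ [y]) \<and> set R \<subseteq> Z0 \<and> 2 * n + 1 \<le> length R)"
    using Suc.IH[OF Z0(1) _ Z0(4,5), of "W \<inter> Z0 - ball 3 w"] Z0 by blast
  have "\<exists>R. ipath (x # R @ [y]) \<and> set R \<subseteq> Z \<and> 2 * Suc n + 1 \<le> length R"
    if v: "v \<in> W'" and y: "y \<notin> insert x Z" "E v y" for v y
  proof -
    have "y \<notin> insert w Z0" using y Z0 m by blast
    then obtain R where R: "ipath (w # R @ [y])" "set R \<subseteq> Z0" "2 * n + 1 \<le> length R"
      using W'(3) v y by blast
    have vx: "v \<notin> ball 3 x" using v W' Suc.prems by blast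
    \<comment> \<open>An edge from x or m to y would put v within distance three of x.\<close>
    have xy: "\<not> E x y" using ball3_step(2)[of x y v] sym[OF y(2)] vx by blast
    have my: "\<not> E m y" using ball3_step(3)[of x m y v] sym[OF y(2)] vx m unfolding N_def by blast
    have mN: "m \<in> Z" "E x m" using m by (auto simp: N_def)
    have xr: "\<not> E x r" "r \<noteq> x" and mr: "\<not> E m r" "r \<noteq> m" if "r \<in> set R" for r
      using that R(2) Z0(2) m(1) Suc.prems(2) unfolding B_def N_def by blast+
    have mw: "m \<noteq> w" and ym: "m \<noteq> y" and xm: "x \<noteq> m" and xw': "x \<noteq> w" and xy': "x \<noteq> y"
      using m(2) irrefl mN y(1) m(3) Suc.prems(2) by blast+
    have "ipath (m # w # R @ [y])"
    proof (rule ipath_ConsI[OF R(1)])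
      show "m \<notin> set (w # R @ [y])" using mw ym mr(2) by auto
      show "\<not> E m u" if "u \<in> set (tl (w # R @ [y]))" for u using that mr(1) my by auto
    qed (simp add: m(2))
    then have "ipath (x # m # w # R @ [y])"
    proof (rule ipath_ConsI)
      show "x \<notin> set (m # w # R @ [y])" using xm xw' xy' xr(2) by auto
      show "\<not> E x u" if "u \<in> set (tl (m # w # R @ [y]))" for u using that xr(1) xw xy by auto
    qed (simp add: mN(2))
    moreover have "set (m # w # R) \<subseteq> Z" using R(2) m(3) mN(1) Z0(2) by auto
    moreover have "2 * Suc n + 1 \<le> length (m # w # R)" using R(3) by simp
    ultimately show ?thesis by (metis append_Cons)
  qed
  then show ?case using W' by blast
qed

text \<open>Here the path leaves a prescribed set B. Its root w comes from
  \<open>cut_component\<close>, and two extra colours pay for the ball around w. Since R avoids B, a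
  vertex whose neighbours in K all lie in B sees no vertex of R.\<close>

lemma grow_from_cut:
  assumes col3: "\<And>u. colorable (ball 3 u) 2"
    and K: "connected_set K" "B \<subseteq> K" "B \<noteq> {}" and W: "W \<subseteq> K - B" "\<not> colorable W (c + 2 * n + 2)"
  obtains w W' where "w \<in> B" "W' \<subseteq> W" "\<not> colorable W' c"
    "\<forall>v\<in>W'. \<forall>y. y \<notin> K \<longrightarrow> E v y \<longrightarrow>
      (\<exists>R. ipath (w # R @ [y]) \<and> set R \<subseteq> K - B \<and> 2 * n + 1 \<le> length R)"
proof -
  from cut_component[OF K W] obtain Z w z
    where Z: "connected_set Z" "Z \<subseteq> K - B" "w \<in> B" "z \<in> Z" "E w z" "\<not> colorable (W \<inter> Z) (c + 2 * n + 2)" .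
  have "\<not> colorable (W \<inter> Z - ball 3 w) (c + 2 * n)" using Z(6) col3 by (rule not_colorable_Diff)
  then obtain W' where W': "W' \<subseteq> W \<inter> Z - ball 3 w" "\<not> colorable W' c"
    "\<forall>v\<in>W'. \<forall>y. y \<notin> insert w Z \<longrightarrow> E v y \<longrightarrow>
      (\<exists>R. ipath (w # R @ [y]) \<and> set R \<subseteq> Z \<and> 2 * n + 1 \<le> length R)"
    using grow[OF col3 Z(1) _ Z(4,5), of "W \<inter> Z - ball 3 w" c n] Z by blast
  show ?thesis
  proof (rule that[OF Z(3) _ W'(2)])
    show "W' \<subseteq> W" using W' by blast
    have "insert w Z \<subseteq> K" using Z K by blast
    then show "\<forall>v\<in>W'. \<forall>y. y \<notin> K \<longrightarrow> E v y \<longrightarrow>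
        (\<exists>R. ipath (w # R @ [y]) \<and> set R \<subseteq> K - B \<and> 2 * n + 1 \<le> length R)"
      using W'(3) Z(2) by (meson subset_trans subsetD)
  qed
qed

end

section \<open>Parity of paths between three terminals\<close>

locale triangle_free_sgraph = sgraph +
  assumes tri: "E u v \<Longrightarrow> E v w \<Longrightarrow> \<not> E u w"
begin

text \<open>Join \<open>c\<close> to a geodesic from \<open>a\<close> to \<open>b\<close> by a shortest path: as there are no
  triangles, its last vertex has one neighbour on the geodesic or two at distance two.\<close>

lemma three_terminals:
  assumes X: "connected_set X" and abc: "a \<in> X" "b \<in> X" "c \<in> X"
  obtains P Q R where "ipath_in X a b P" "ipath_in X a c Q" "ipath_in X b c R"
    "odd (length P + length Q + length R)"
proof -
  define A where "A = (ARG_MIN length A. ipath_in X a b A)"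
  have "\<exists>A. ipath_in X a b A" using X abc unfolding connected_set_def by blast
  then have A: "ipath_in X a b A" and Amin: "\<And>P. ipath_in X a b P \<Longrightarrow> length A \<le> length P"
    unfolding A_def using arg_min_natI[of "ipath_in X a b" _ length] arg_min_nat_le[of "ipath_in X a b" _ length] by blast+
  have Ane: "A \<noteq> []" using A by (rule ipath_in_nonempty)
  show ?thesis
  proof (cases "c \<in> set A")
    case True
    then obtain A1 A2 where s: "A = A1 @ c # A2" by (meson split_list)
    have i: "ipath ((A1 @ [c]) @ A2)" "ipath (A1 @ c # A2)" using A s by (auto simp: ipath_in_def)
    have "ipath_in X a c (A1 @ [c])" using ipath_append1[OF i(1)] A s by (cases A1) (auto simp: ipath_in_def)
    moreover have "ipath_in X c b (c # A2)" using ipath_append2[OF i(2)] A s by (auto simp: ipath_in_def)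
    then have "ipath_in X b c (rev (c # A2))" by (rule ipath_in_sym)
    ultimately show ?thesis by (rule that[OF A]) (use s in auto)
  next
    case False
    \<comment> \<open>The path from c stops at the first vertex r on or next to A. It cannot be on
      A, since its predecessor would already have been in this set.\<close>
    let ?T = "set A \<union> {x. \<exists>y\<in>set A. E x y}"
    obtain xs where xs: "ipath_in X c a xs" using X abc unfolding connected_set_def by blast
    have "a \<in> set xs" using last_in_set[OF ipath_in_nonempty[OF xs]] xs by (simp add: ipath_in_def)
    moreover have "a \<in> set A" using Ane A hd_in_set[OF Ane] by (simp add: ipath_in_def)
    ultimately have "set xs \<inter> ?T \<noteq> {}" by blast
    then obtain ys r where r: "ipath_in X c r (ys @ [r])" "r \<in> ?T" "set ys \<inter> ?T = {}"
      by (rule ipath_in_first[OF xs])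
    have rA: "r \<notin> set A"
    proof
      assume rA: "r \<in> set A"
      then have "ys \<noteq> []" using r(1) False by (auto simp: ipath_in_def)
      then have "E (last ys) r" "last ys \<in> set ys" using r(1) by (auto simp: ipath_in_def ipath_append)
      then show False using r(3) rA by blast
    qed
    let ?B = "rev (ys @ [r])"
    have B: "ipath_in X r c ?B" using r(1) by (rule ipath_in_sym)
    have ex: "\<exists>y\<in>set A. E r y" using r(2) rA by blast
    obtain A1 x A2 where s1: "A = A1 @ x # A2" "E r x" "\<forall>y\<in>set A1. \<not> E r y"
      using split_list_first_prop[OF ex] by blast
    obtain A3 x' A4 where s2: "A = A3 @ x' # A4" "E r x'" "\<forall>y\<in>set A4. \<not> E r y"
      using split_list_last_prop[OF ex] by blast
    have iA: "ipath ((A1 @ [x]) @ A2)" "ipath (A3 @ x' # A4)" using A s1 s2 by (auto simp: ipath_in_def)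
    have i1: "ipath_in X a x (A1 @ [x])" using ipath_append1[OF iA(1)] A s1 by (cases A1) (auto simp: ipath_in_def)
    have i3: "ipath_in X x' b (x' # A4)" using ipath_append2[OF iA(2)] A s2 by (auto simp: ipath_in_def)
    from ipath_in_sym[OF this] have i2: "ipath_in X b x' (rev A4 @ [x'])" by simp
    have glue: "ipath_in X u c (D @ [t] @ ?B)"
      if D: "ipath_in X u t (D @ [t])" "E r t" "\<forall>y\<in>set D. \<not> E r y" "set (D @ [t]) \<subseteq> set A" for u t D
    proof -
      have "\<not> E p q" if "p \<in> set (D @ [t])" "q \<in> set ys" for p q
        using that D(4) r(3) sym by blast
      moreover have "set (D @ [t]) \<inter> set (ys @ [r]) = {}" using D(4) rA r(3) by auto
      moreover have "\<not> E p r" if "p \<in> set D" for p using that D(3) sym by blast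
      ultimately have "ipath ((D @ [t]) @ ?B)"
        using D(1,2) B sym[of r t] by (subst ipath_append) (auto simp: ipath_in_def)
      then show ?thesis using D(1) B by (cases D) (auto simp: ipath_in_def)
    qed
    have g1: "ipath_in X a c (A1 @ [x] @ ?B)" by (rule glue[OF i1]) (use s1 in auto)
    have g2: "ipath_in X b c (rev A4 @ [x'] @ ?B)" by (rule glue[OF i2]) (use s2 in auto)
    have le: "length A1 \<le> length A3"
    proof (rule ccontr)
      assume "\<not> length A1 \<le> length A3"
      then have "x' = A1 ! length A3" "length A3 < length A1"
        using s1(1) s2(1) by (metis nth_append nth_append_length not_le)+
      then show False using s1(3) s2(2) by (metis nth_mem)
    qed
    have len: "length A = length A3 + 1 + length A4" using s2 by simp
    have diff: "length A3 = length A1 \<or> length A3 = length A1 + 2"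
    proof -
      have "length A3 \<le> length A1 + 2"
      proof (rule ccontr)
        \<comment> \<open>If the first and last neighbours of r on A are more than two apart, the
          detour through r is a shorter induced path from a to b.\<close>
        assume gt: "\<not> length A3 \<le> length A1 + 2"
        obtain us where us: "A3 = A1 @ us" "x # A2 = us @ x' # A4"
          using s1(1) s2(1) gt by (auto simp: append_eq_append_conv2)
        then obtain M where us': "us = x # M" using gt by (cases us) auto
        then have M: "M \<noteq> []" and sub: "A3 = A1 @ x # M" using us gt by auto
        have "ipath A" using A by (simp add: ipath_in_def)
        have D: "set (A1 @ [x]) \<inter> set (x' # A4) = {}" "\<forall>p\<in>set (A1 @ [x]). \<forall>q\<in>set (x' # A4). \<not> E p q"
        proof -
          have AM: "A = (A1 @ [x]) @ (M @ x' # A4)" using s2(1) sub by simp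
          have j: "ipath ((A1 @ [x]) @ M @ (x' # A4))" using \<open>ipath A\<close> AM by simp
          show "set (A1 @ [x]) \<inter> set (x' # A4) = {}"
            using ipath_far_apart(1)[OF j _ M] by blast
          show "\<forall>p\<in>set (A1 @ [x]). \<forall>q\<in>set (x' # A4). \<not> E p q"
            using ipath_far_apart(2)[OF j _ M] by blast
        qed
        have "ipath ([r] @ x' # A4)"
          using ipath_append2[OF iA(2)] rA s2 by (subst ipath_append) auto
        then have "ipath ((A1 @ [x]) @ ([r] @ x' # A4))"
          using ipath_append1[OF iA(1)] D rA s1 sym by (subst ipath_append) auto
        then have "ipath_in X a b ((A1 @ [x]) @ ([r] @ x' # A4))"
          using i1 i3 ipath_in_mem(1)[OF B] by (auto simp: ipath_in_def hd_append)
        from Amin[OF this] show False using len gt by simp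
      qed
      moreover have "length A3 \<noteq> length A1 + 1"
      proof
        \<comment> \<open>Consecutive neighbours would form a triangle with r.\<close>
        assume eq: "length A3 = length A1 + 1"
        have "A3 = A1 @ [x]"
          using arg_cong[OF s1(1)[symmetric], of "take (length A3)"] s2(1) eq by simp
        then have "E x x'" using iA(2) ipath_append[of A3 "x' # A4"] by simp
        then show False using tri s1(2) s2(2) by blast
      qed
      ultimately show ?thesis using le by linarith
    qed
    \<comment> \<open>Up to even terms the three lengths add up to
      \<open>length A1 + length A3 + 3\<close>, which is odd because the two lengths differ by 0 or
      2.\<close>
    show ?thesis
      by (rule that[OF A g1 g2]) (use len diff in auto)
  qed
qed

end

section \<open>Graphs without short or long odd holes\<close>

locale hole_restricted = triangle_free_sgraph +
  fixes l :: nat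
  assumes l_ge: "2 \<le> l"
    and no5: "icycle xs \<Longrightarrow> length xs \<noteq> 5"
    and no7: "icycle xs \<Longrightarrow> length xs \<noteq> 7"
    and no_long: "icycle xs \<Longrightarrow> odd (length xs) \<Longrightarrow> length xs < 2 * l + 3"
begin

section \<open>Balls of radius three are bipartite\<close>

lemma closed_5walk:
  assumes "E a b" "E b c" "E c d" "E d e" "E e a" shows False
proof -
  note r = assms assms[THEN sym]
  have "\<not> E a c" "\<not> E a d" "\<not> E b d" "\<not> E b e" "\<not> E c e" "\<not> E c a" using r tri by blast+
  moreover have "a \<noteq> c" "a \<noteq> d" "b \<noteq> d" "b \<noteq> e" "c \<noteq> e" using r tri irrefl by blast+
  moreover have "a \<noteq> b" "b \<noteq> c" "c \<noteq> d" "d \<noteq> e" "e \<noteq> a" using r irrefl by blast+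
  ultimately have "icycle [a, b, c, d, e]" using r by (auto simp: icycle_def ipath.simps)
  then show False using no5 by fastforce
qed

text \<open>A coincidence or chord between two vertices of the walk cuts off a closed walk of length
  3 or 5. The fact \<open>R\<close> records this for one starting vertex and is applied to all seven
  rotations.\<close>

lemma closed_7walk:
  assumes "E a b" "E b c" "E c d" "E d e" "E e f" "E f g" "E g a" shows False
proof -
  have R: "x0 \<noteq> x1 \<and> x0 \<noteq> x2 \<and> \<not> E x0 x2 \<and> x0 \<noteq> x3 \<and> \<not> E x0 x3"
    if "E x0 x1" "E x1 x2" "E x2 x3" "E x3 x4" "E x4 x5" "E x5 x6" "E x6 x0" for x0 x1 x2 x3 x4 x5 x6
    using that closed_5walk[of x2 x3 x4 x5 x6] closed_5walk[of x0 x3 x4 x5 x6] tri[of x0 x1 x2] tri[of x0 x1 x2]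
      irrefl sym by blast
  note r = R[OF assms(1,2,3,4,5,6,7)] R[OF assms(2,3,4,5,6,7,1)] R[OF assms(3,4,5,6,7,1,2)]
    R[OF assms(4,5,6,7,1,2,3)] R[OF assms(5,6,7,1,2,3,4)] R[OF assms(6,7,1,2,3,4,5)] R[OF assms(7,1,2,3,4,5,6)]
  have "\<not> E a e" "\<not> E a f" "\<not> E b f" "\<not> E b g" "\<not> E c g" using r sym by blast+
  then have "icycle [a, b, c, d, e, f, g]" using r assms sym[OF assms(7)] by (auto simp: icycle_def ipath.simps)
  then show False using no7 by fastforce
qed

text \<open>An edge inside level k, together with paths of parents from both ends up to z, is a
  closed walk of length 2k + 1, that is 1, 3, 5 or 7.\<close>

lemma level_stable: assumes "u \<in> level z k" "v \<in> level z k" "k \<le> 3" shows "\<not> E u v"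
proof
  assume e: "E u v"
  have par: "\<exists>p. p \<in> level z (i - 1) \<and> E p x" if "x \<in> level z i" "i > 0" for x i
    using that by (cases i) (auto elim: level_parent)
  consider "k = 0" | "k = 1" | "k = 2" | "k = 3" using assms(3) by linarith
  then show False
  proof cases
    case 1
    then show ?thesis using assms e irrefl by (simp add: level_0)
  next
    case 2
    then have "E z u" "E z v" using par[OF assms(1)] par[OF assms(2)] by (auto simp: level_0)
    then show ?thesis using e tri sym by blast
  next
    case 3
    then obtain p q where p: "p \<in> level z 1" "E p u" and q: "q \<in> level z 1" "E q v"
      using par[OF assms(1)] par[OF assms(2)] by auto
    have "E z p" "E z q" using par[OF p(1)] par[OF q(1)] by (auto simp: level_0)
    then show ?thesis using closed_5walk[of z p u v q] p q e sym by blast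
  next
    case 4
    then obtain p q where p: "p \<in> level z 2" "E p u" and q: "q \<in> level z 2" "E q v"
      using par[OF assms(1)] par[OF assms(2)] by auto
    obtain p' q' where p': "p' \<in> level z 1" "E p' p" and q': "q' \<in> level z 1" "E q' q"
      using par[OF p(1)] par[OF q(1)] by auto
    have "E z p'" "E z q'" using par[OF p'(1)] par[OF q'(1)] by (auto simp: level_0)
    then show ?thesis using closed_7walk[of z p' p u v q q'] p q p' q' e sym by blast
  qed
qed

lemma colorable_ball3: "colorable (ball 3 u) 2"
proof -
  have "depth u v mod 2 \<noteq> depth u w mod 2" if v: "v \<in> ball 3 u" and w: "w \<in> ball 3 u" and e: "E v w" for v w
  proof
    assume p: "depth u v mod 2 = depth u w mod 2"
    have "depth u v \<le> Suc (depth u w)" "depth u w \<le> Suc (depth u v)" using level_adj[OF level_depth[OF v] level_depth[OF w] e] by auto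
    with p have "depth u v = depth u w" by presburger
    then show False using level_stable[OF level_depth[OF v], of w] level_depth[OF w] depth_le[OF v] e by simp
  qed
  then show ?thesis unfolding colorable_def by (intro exI[of _ "\<lambda>v. depth u v mod 2"]) simp
qed

section \<open>Paths through the lower levels\<close>

definition levels_upto :: "'a \<Rightarrow> nat \<Rightarrow> 'a set" where
  "levels_upto z m = (\<Union>j\<in>{..m}. level z j)"

lemma levels_upto_apart: assumes "x \<in> level z (Suc (Suc m))" "i \<in> levels_upto z m" shows "x \<noteq> i \<and> \<not> E x i"
proof -
  obtain j where "i \<in> level z j" "j \<le> m" using assms(2) by (auto simp: levels_upto_def)
  then show ?thesis using level_adj[OF assms(1), of i j] level_inj[OF assms(1), of j] by auto
qed

text \<open>This says that the distance is at least three, or infinite. Far vertices of a level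
  cannot share a parent.\<close>

definition far :: "'a \<Rightarrow> 'a \<Rightarrow> bool" where
  "far u v \<longleftrightarrow> u \<noteq> v \<and> \<not> E u v \<and> (\<forall>x. E u x \<longrightarrow> \<not> E v x)"

lemma far_sym: "far u v \<Longrightarrow> far v u"
  unfolding far_def using sym by blast

lemma far_if_ball: assumes "v \<notin> ball 3 u" "E v p" shows "far u p"
proof -
  have "E p v" using assms(2) by (rule sym)
  moreover have "E x p" if "E p x" for x using that by (rule sym)
  ultimately show ?thesis unfolding far_def using assms(1) ball3_step by meson
qed

lemma far_path_length: assumes "far u v" "ipath (u # I @ [v])" shows "2 \<le> length I"
proof (rule ccontr)
  assume "\<not> 2 \<le> length I"
  then consider "I = []" | i where "I = [i]" by (cases I) (auto simp: Suc_le_eq)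
  then show False
  proof cases
    case 1
    then show ?thesis using assms by (simp add: far_def ipath.simps)
  next
    case 2
    then have "E u i" "E i v" using assms(2) by (auto simp: ipath.simps)
    then show ?thesis using assms(1) sym unfolding far_def by blast
  qed
qed

lemma ipath_cap:
  assumes P: "ipath_in X a b P" and "E u a" "E b v" "u \<noteq> v" "\<not> E u v" "u \<notin> X" "v \<notin> X"
    and "\<And>x. x \<in> X \<Longrightarrow> E u x \<Longrightarrow> x = a" "\<And>x. x \<in> X \<Longrightarrow> E v x \<Longrightarrow> x = b"
  shows "ipath (u # P @ [v])"
proof (rule ipath_ConsI)
  have ne: "P \<noteq> []" using P by (rule ipath_in_nonempty)
  show "ipath (P @ [v])" using P assms(3,7,9) sym ne by (subst ipath_append) (auto simp: ipath_in_def)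
  show "E u (hd (P @ [v]))" using P assms(2) ne by (simp add: ipath_in_def)
  show "u \<notin> set (P @ [v])" using P assms(4,6) by (auto simp: ipath_in_def)
  obtain P' where P': "P = a # P'" using P ne by (cases P) (auto simp: ipath_in_def)
  then have "a \<notin> set P'" using P by (auto simp: ipath_in_def ipath_notin)
  then show "\<not> E u y" if "y \<in> set (tl (P @ [v]))" for y
    using that P P' assms(5,8) by (auto simp: ipath_in_def)
qed

text \<open>Choose parents a, b, c and apply \<open>three_terminals\<close> to them. As u, v, w are
  pairwise far, each sees only its own parent in the set used, so all three paths can be prolonged
  to u, v, w. The last conclusion serves to keep a fourth vertex of the level off these
  paths.\<close>

lemma paths_through_lower_levels:
  assumes uvw: "u \<in> level z (Suc m)" "v \<in> level z (Suc m)" "w \<in> level z (Suc m)"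
    and f: "far u v" "far u w" "far v w"
  obtains I J K where "ipath (u # I @ [v])" "ipath (u # J @ [w])" "ipath (v # K @ [w])"
    "odd (length I + length J + length K)" "set I \<union> set J \<union> set K \<subseteq> levels_upto z m"
    "\<forall>i\<in>set I \<union> set J \<union> set K. \<forall>x\<in>level z (Suc m). E x i \<longrightarrow> E u i \<or> E v i \<or> E w i"
proof -
  obtain a where a: "a \<in> level z m" "E a u" using level_parent uvw(1) by blast
  obtain b where b: "b \<in> level z m" "E b v" using level_parent uvw(2) by blast
  obtain c where c: "c \<in> level z m" "E c w" using level_parent uvw(3) by blast
  define X where "X = {a, b, c} \<union> (\<Union>j\<in>{..<m}. level z j)"
  have Xr: "\<exists>xs. ipath_in X x z xs" if "x \<in> X" for x
  proof -
    have "\<exists>j\<le>m. x \<in> level z j" using that a b c unfolding X_def by (auto intro: less_imp_le)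
    then obtain j where j: "x \<in> level z j" "j \<le> m" by blast
    show ?thesis by (rule ipath_in_root[OF j(1) that]) (use j(2) in \<open>auto simp: X_def\<close>)
  qed
  have "connected_set X" unfolding connected_set_def using Xr ipath_in_sym ipath_in_trans by meson
  then obtain P Q R where P: "ipath_in X a b P" and Q: "ipath_in X a c Q" and R: "ipath_in X b c R"
    and o: "odd (length P + length Q + length R)"
    by (rule three_terminals[of X a b c]) (auto simp: X_def)
  have low: "x \<notin> X \<and> (\<forall>i\<in>X. E x i \<longrightarrow> i \<in> {a, b, c})" if "x \<in> level z (Suc m)" for x
  proof -
    have "x \<noteq> i \<and> \<not> E x i" if "i \<in> level z j" "j < m" for i j
      using level_adj[OF \<open>x \<in> level z (Suc m)\<close> that(1)] level_inj[OF \<open>x \<in> level z (Suc m)\<close>, of j] that by auto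
    moreover have "x \<notin> {a, b, c}" using level_inj[OF that, of m] a b c by auto
    ultimately show ?thesis unfolding X_def by blast
  qed
  have ua: "i = a" if "i \<in> X" "E u i" for i using low[OF uvw(1)] that a b c f unfolding far_def by (metis insertE singletonD sym)
  have vb: "i = b" if "i \<in> X" "E v i" for i using low[OF uvw(2)] that a b c f unfolding far_def by (metis insertE singletonD sym)
  have wc: "i = c" if "i \<in> X" "E w i" for i using low[OF uvw(3)] that a b c f unfolding far_def by (metis insertE singletonD sym)
  have nX: "u \<notin> X" "v \<notin> X" "w \<notin> X" using low uvw by blast+
  have F: "u \<noteq> v" "u \<noteq> w" "v \<noteq> w" "\<not> E u v" "\<not> E u w" "\<not> E v w" using f by (auto simp: far_def)
  have S: "set P \<union> set Q \<union> set R \<subseteq> X" using P Q R by (auto simp: ipath_in_def)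
  show ?thesis
  proof (rule that[of P Q R])
    show "ipath (u # P @ [v])" using ipath_cap[OF P sym[OF a(2)] b(2) F(1,4) nX(1,2)] ua vb by blast
    show "ipath (u # Q @ [w])" using ipath_cap[OF Q sym[OF a(2)] c(2) F(2,5) nX(1,3)] ua wc by blast
    show "ipath (v # R @ [w])" using ipath_cap[OF R sym[OF b(2)] c(2) F(3,6) nX(2,3)] vb wc by blast
    show "odd (length P + length Q + length R)" by (rule o)
    show "set P \<union> set Q \<union> set R \<subseteq> levels_upto z m" using S a b c by (fastforce simp: X_def levels_upto_def)
    show "\<forall>i\<in>set P \<union> set Q \<union> set R. \<forall>x\<in>level z (Suc m). E x i \<longrightarrow> E u i \<or> E v i \<or> E w i"
    proof (intro ballI impI)
      fix i x assume "i \<in> set P \<union> set Q \<union> set R" "x \<in> level z (Suc m)" "E x i"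
      then have "i \<in> {a, b, c}" using low S by blast
      then show "E u i \<or> E v i \<or> E w i" using a b c sym by blast
    qed
  qed
qed

section \<open>Parity of long closing paths\<close>

text \<open>Far ends force at least two vertices into I, so the two paths form an induced cycle on
  at least 2l + 2 vertices. An odd one would have at least 2l + 3.\<close>

lemma closing_parity:
  assumes M: "ipath M" "hd M = u" "last M = v" and I: "ipath (v # I @ [u])" "far u v"
    and len: "2 * l \<le> length M"
    and dis: "\<And>x i. x \<in> set M \<Longrightarrow> i \<in> set I \<Longrightarrow> x \<noteq> i \<and> (E x i \<longrightarrow> x = u \<or> x = v)"
  shows "even (length M + length I)"
proof (rule ccontr)
  assume o: "odd (length M + length I)"
  have I2: "2 \<le> length I" using far_path_length[OF far_sym[OF I(2)] I(1)] .
  have "icycle (M @ I)"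
    by (rule icycle_glue) (use M I(1) I2 len l_ge dis in auto)
  moreover have "odd (length (M @ I))" using o by simp
  ultimately have "length (M @ I) < 2 * l + 3" by (rule no_long)
  then show False using o len I2 by (simp, presburger)
qed

lemma levels_upto_notin: "x \<in> level z (Suc m) \<Longrightarrow> x \<notin> levels_upto z m"
  unfolding levels_upto_def using level_inj[of x z "Suc m"] by fastforce

text \<open>For fixed v, one long path from q through C to \<open>pa v\<close> closes with every
  path back through the lower levels, so all the latter have the same parity. Splitting by this
  parity leaves one class of large chromatic number.\<close>

lemma uniform_parity_exists:
  assumes C: "C \<subseteq> level z (Suc (Suc m))" "connected_set C" "\<not> colorable C (6 * l + 4)"
    and pa: "\<And>v. v \<in> C \<Longrightarrow> pa v \<in> level z (Suc m) \<and> E v (pa v)"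
  obtains q A e where "q \<in> level z (Suc m)" "A \<subseteq> C" "\<not> colorable A (2 * l + 2)"
    "\<forall>v\<in>A. far q (pa v)"
    "\<forall>v\<in>A. \<forall>I. ipath (pa v # I @ [q]) \<longrightarrow> set I \<subseteq> levels_upto z m \<longrightarrow> even (length I) = e"
proof -
  have pC: "p \<notin> C" if "p \<in> level z (Suc m)" for p
    using C(1) that level_inj[of p z "Suc m" "Suc (Suc m)"] by auto
  have "C \<noteq> {}" using C(3) by (auto simp: colorable_def)
  then obtain c0 where c0: "c0 \<in> C" by blast
  define q where "q = pa c0"
  have q: "q \<in> level z (Suc m)" "E q c0" using pa[OF c0] sym by (auto simp: q_def)
  define B where "B = {v \<in> C. E q v}"
  have B: "B \<subseteq> C" "B \<noteq> {}" using q c0 by (auto simp: B_def)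
  define W where "W = C - ball 3 q"
  \<comment> \<open>The budget: 2 colours for the ball around q, 2 for the ball around w, 2(l - 2)
    for the rounds of \<open>grow\<close>, and 4l + 4 left for two parity classes of 2l + 2 each.
    The subtraction is genuine by \<open>l_ge\<close>.\<close>
  have "6 * l + 4 = 6 * l + 2 + 2" by simp
  then have "\<not> colorable C (6 * l + 2 + 2)" using C(3) by metis
  then have "\<not> colorable W (6 * l + 2)" unfolding W_def using colorable_ball3 by (rule not_colorable_Diff)
  moreover have "6 * l + 2 = (4 * l + 4) + 2 * (l - 2) + 2" using l_ge by simp
  ultimately have Wcol: "\<not> colorable W ((4 * l + 4) + 2 * (l - 2) + 2)" by metis
  have WB: "W \<subseteq> C - B" unfolding W_def B_def using ball3_step(1) by blast
  obtain w W' where w: "w \<in> B" and W': "W' \<subseteq> W" "\<not> colorable W' (4 * l + 4)"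
    and grown: "\<forall>v\<in>W'. \<forall>y. y \<notin> C \<longrightarrow> E v y \<longrightarrow>
      (\<exists>R. ipath (w # R @ [y]) \<and> set R \<subseteq> C - B \<and> 2 * (l - 2) + 1 \<le> length R)"
    by (rule grow_from_cut[OF colorable_ball3 C(2) B WB Wcol])
  have fq: "far q (pa v)" if "v \<in> W'" for v
    using far_if_ball[of v q "pa v"] that W'(1) pa[of v] unfolding W_def by blast
  define F where "F = (\<lambda>v e. \<forall>I. ipath (pa v # I @ [q]) \<longrightarrow> set I \<subseteq> levels_upto z m \<longrightarrow> even (length I) = e)"
  have par: "\<exists>e. F v e" if v: "v \<in> W'" for v
  proof -
    let ?y = "pa v"
    have vC: "v \<in> C" using v W' by (auto simp: W_def)
    have y: "?y \<in> level z (Suc m)" "E v ?y" "?y \<notin> C" using pa[OF vC] pC by auto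
    obtain R where R: "ipath (w # R @ [?y])" "set R \<subseteq> C - B" "2 * (l - 2) + 1 \<le> length R"
      using grown v y(2,3) by blast
    let ?M = "q # w # R @ [?y]"
    have fy: "q \<noteq> ?y" "\<not> E q ?y" using fq[OF v] by (auto simp: far_def)
    have Mi: "ipath ?M"
    proof (rule ipath_ConsI[OF R(1)])
      show "E q (hd (w # R @ [?y]))" using w by (simp add: B_def)
      show "q \<notin> set (w # R @ [?y])" using pC[OF q(1)] R(2) w B fy by auto
      show "\<not> E q u" if "u \<in> set (tl (w # R @ [?y]))" for u
        using that R(2) fy by (auto simp: B_def)
    qed
    have Md: "x \<noteq> i \<and> (E x i \<longrightarrow> x = q \<or> x = ?y)" if x: "x \<in> set ?M" and i: "i \<in> levels_upto z m" for x i
    proof (cases "x \<in> C")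
      case True
      then show ?thesis using levels_upto_apart[OF _ i] C(1) by blast
    next
      case False
      then have "x = q \<or> x = ?y" using x R(2) w B by auto
      then show ?thesis using levels_upto_notin[OF q(1)] levels_upto_notin[OF y(1)] i by auto
    qed
    \<comment> \<open>At least 2(l - 2) + 1 vertices in R, together with q, w and the parent, give
      exactly the required 2l.\<close>
    have Ml: "2 * l \<le> length ?M" using R(3) l_ge by simp
    have "even (length ?M + length I)" if I: "ipath (?y # I @ [q])" "set I \<subseteq> levels_upto z m" for I
      by (rule closing_parity[OF Mi _ _ I(1) fq[OF v] Ml]) (use Md I(2) in \<open>simp, simp, blast\<close>)
    then have "F v (even (length ?M))" unfolding F_def even_add by blast
    then show ?thesis by blast
  qed
  define A where "A = (\<lambda>e. {v \<in> W'. F v e})"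
  have "W' \<subseteq> A True \<union> A False" 
  proof
    fix v assume "v \<in> W'"
    moreover from this obtain e where "F v e" using par by blast
    ultimately show "v \<in> A True \<union> A False" unfolding A_def by (cases e) auto
  qed
  then have "colorable W' (4 * l + 4)" if "colorable (A True) (2 * l + 2)" "colorable (A False) (2 * l + 2)"
    by (rule colorable_mono[OF colorable_Un[OF that]]) simp
  then obtain e where e: "\<not> colorable (A e) (2 * l + 2)" using W'(2) by blast
  show ?thesis
  proof (rule that[OF q(1) _ e])
    show "A e \<subseteq> C" using W' by (auto simp: A_def W_def)
    show "\<forall>v\<in>A e. far q (pa v)" using fq by (simp add: A_def)
    show "\<forall>v\<in>A e. \<forall>I. ipath (pa v # I @ [q]) \<longrightarrow> set I \<subseteq> levels_upto z m \<longrightarrow> even (length I) = e"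
      unfolding A_def F_def by blast
  qed
qed

text \<open>Both y and y' can be joined to a far parent p by long paths that share the segment from
  w on, and the parity of such a path is forced by \<open>par\<close>. The way from y to w and the
  way from y' to w can be chosen with different parities, so one of them violates this.\<close>

lemma uniform_parity_contradiction:
  assumes A: "A \<subseteq> level z (Suc (Suc m))" "\<not> colorable A (2 * l + 2)"
    and pa: "\<And>v. v \<in> A \<Longrightarrow> pa v \<in> level z (Suc m) \<and> E v (pa v)"
    and q: "q \<in> level z (Suc m)" and fq: "\<And>v. v \<in> A \<Longrightarrow> far q (pa v)"
    and par: "\<And>v I. v \<in> A \<Longrightarrow> ipath (pa v # I @ [q]) \<Longrightarrow> set I \<subseteq> levels_upto z m \<Longrightarrow> even (length I) = e"
  shows False
proof -
  obtain x0 where "\<not> colorable (component A x0 \<inter> A) (2 * l + 2)" using colorable_components[of A A] A(2) by blast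
  moreover define K where "K = component A x0"
  moreover have KA: "K \<subseteq> A" unfolding K_def by (rule component_subset)
  ultimately have Kcol: "\<not> colorable K (2 * l + 2)" by (simp add: Int_absorb2)
  have Kconn: "connected_set K" unfolding K_def by (rule connected_set_component)
  have KL: "K \<subseteq> level z (Suc (Suc m))" using KA A by blast
  have pK: "p \<notin> level z (Suc (Suc m))" if "p \<in> level z (Suc m)" for p
    using that level_inj[of p z "Suc m" "Suc (Suc m)"] by auto
  have "\<not> colorable K 1" using Kcol colorable_mono[of K 1 K "2 * l + 2"] by auto
  then obtain a a' where aa: "a \<in> K" "a' \<in> K" "E a a'" using colorable_stable[of K] by blast
  define y where "y = pa a"
  define y' where "y' = pa a'"
  have aA: "a \<in> A" "a' \<in> A" using aa KA by auto
  have y: "y \<in> level z (Suc m)" "E a y" "far q y" and y': "y' \<in> level z (Suc m)" "E a' y'" "far q y'"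
    using pa[OF aA(1)] pa[OF aA(2)] fq[OF aA(1)] fq[OF aA(2)] by (auto simp: y_def y'_def)
  \<comment> \<open>A common neighbour would close y, a, a', y' to a closed walk of length
    five.\<close>
  have nc: "\<not> (E y p \<and> E y' p)" for p
    using closed_5walk[of y a a' y' p] aa(3) y(2) y'(2) sym by blast
  define S where "S = {y, a, a', y'}"
  define B where "B = {v \<in> K. \<exists>s\<in>S. E s v}"
  have B: "B \<subseteq> K" "B \<noteq> {}" "a \<in> B" "a' \<in> B" using aa sym by (auto simp: B_def S_def)
  define W where "W = K - ball 3 y - ball 3 y'"
  \<comment> \<open>The budget: 2 colours for each of the balls around y, y' and w and 2(l - 2) for
    the rounds. Nothing remains, and not being colourable with 0 colours just means that the final
    set is nonempty.\<close>
  have "\<not> colorable K (2 * l + 2)" by (rule Kcol)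
  then have "\<not> colorable (K - ball 3 y) (2 * l)" using colorable_ball3 by (rule not_colorable_Diff)
  moreover have "2 * l = 0 + 2 * (l - 2) + 2 + 2" using l_ge by simp
  ultimately have "\<not> colorable (K - ball 3 y) (0 + 2 * (l - 2) + 2 + 2)" by metis
  then have Wcol: "\<not> colorable W (0 + 2 * (l - 2) + 2)" unfolding W_def using colorable_ball3 by (rule not_colorable_Diff)
  have WB: "W \<subseteq> K - B"
    unfolding W_def B_def S_def using ball3_step(1,2) sym[OF y(2)] sym[OF y'(2)] by blast
  obtain w W' where w: "w \<in> B" and W': "W' \<subseteq> W" "\<not> colorable W' 0"
    and grown: "\<forall>v\<in>W'. \<forall>y. y \<notin> K \<longrightarrow> E v y \<longrightarrow>
      (\<exists>R. ipath (w # R @ [y]) \<and> set R \<subseteq> K - B \<and> 2 * (l - 2) + 1 \<le> length R)"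
    by (rule grow_from_cut[OF colorable_ball3 Kconn B(1,2) WB Wcol])
  have "W' \<noteq> {}" using W'(2) by (auto simp: colorable_def)
  then obtain v where v: "v \<in> W'" by blast
  have vK: "v \<in> K" "v \<notin> ball 3 y" "v \<notin> ball 3 y'" using v W' by (auto simp: W_def)
  then have vA: "v \<in> A" using KA by blast
  define p where "p = pa v"
  have p: "p \<in> level z (Suc m)" "E v p" "far q p" using pa[OF vA] fq[OF vA] by (auto simp: p_def)
  have fp: "far y p" "far y' p" using far_if_ball vK p(2) by auto
  have "p \<notin> K" using pK[OF p(1)] KL by blast
  then obtain R where R: "ipath (w # R @ [p])" "set R \<subseteq> K - B" "2 * (l - 2) + 1 \<le> length R"
    using grown v p(2) by blast
  have Sp: "\<not> E s p" "s \<noteq> p" if "s \<in> S" for s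
  proof -
    have "\<not> E a p" "\<not> E a' p" using fp sym[OF y(2)] sym[OF y'(2)] sym unfolding far_def by blast+
    moreover have "a \<noteq> p" "a' \<noteq> p" using aa \<open>p \<notin> K\<close> by auto
    ultimately show "\<not> E s p" "s \<noteq> p" using that fp unfolding S_def far_def by auto
  qed
  \<comment> \<open>A leg P runs inside S from s to a neighbour of w. The lower paths from p and
    from s to q have the same parity by \<open>par\<close>, hence the one from p to s has an odd
    number of inner vertices. Closing the cycle fixes the parity of P against that of R, so all legs
    have the same parity.\<close>
  have leg: "odd (length P + length R)"
    if st: "(s = y \<and> t = y' \<and> b = a) \<or> (s = y' \<and> t = y \<and> b = a')"
      and P: "ipath (P @ [w])" "P \<noteq> []" "hd P = s" "set P \<subseteq> S" for s t b P
  proof -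
    have s: "s \<in> level z (Suc m)" "far s p" "far q s" "t \<in> level z (Suc m)" "far t p" "far q t" "b \<in> A" "s = pa b"
      using st y y' fp aA by (auto simp: y_def y'_def)
    have nst: "\<not> (E s i \<and> E t i)" for i using st nc by blast
    obtain I J N where IJN: "ipath (p # I @ [s])" "ipath (p # J @ [q])" "ipath (s # N @ [q])"
      "odd (length I + length J + length N)" "set I \<union> set J \<union> set N \<subseteq> levels_upto z m"
      and near: "\<forall>i\<in>set I \<union> set J \<union> set N. \<forall>x\<in>level z (Suc m). E x i \<longrightarrow> E p i \<or> E s i \<or> E q i"
      by (rule paths_through_lower_levels[OF p(1) s(1) q far_sym[OF s(2)] far_sym[OF p(3)] far_sym[OF s(3)]])
    have "even (length J) = e" using par[OF vA] IJN(2,5) by (simp add: p_def)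
    moreover have "even (length N) = e" using par[OF s(7)] IJN(3,5) s(8) by simp
    ultimately have oI: "odd (length I)" using IJN(4) by auto
    let ?M = "P @ w # R @ [p]"
    have SR: "s \<notin> K - B" "r \<in> K - B \<Longrightarrow> \<not> E s r" if "s \<in> S" for s r
      using that B(3,4) pK[OF y(1)] pK[OF y'(1)] KL unfolding B_def S_def by blast+
    have lw: "x = last P" if "x \<in> set P" "E x w" for x
      using P(1,2) that by (simp add: ipath_append)
    have "set P \<inter> set (w # R @ [p]) = {}"
      using P(1,2,4) SR(1) R(2) Sp(2) by (auto simp: ipath_append)
    moreover have "x = last P \<and> u = w" if "x \<in> set P" "u \<in> set (w # R @ [p])" "E x u" for x u
      using that lw[of x] SR(2)[of x u] Sp(1)[of x] P(4) R(2) by auto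
    moreover have "E (last P) w" "ipath P" using P(1,2) by (auto simp: ipath_append)
    ultimately have M: "ipath ?M" using R(1) P(2) by (subst ipath_append) auto
    have dis: "x \<noteq> i \<and> (E x i \<longrightarrow> x = s \<or> x = p)" if x: "x \<in> set ?M" and i: "i \<in> set I" for x i
    proof (cases "x \<in> K")
      case True
      then show ?thesis using levels_upto_apart[of x z m i] KL i IJN(5) by blast
    next
      case False
      have "x = s \<or> x = p \<or> x = t" using x False P(4) R(2) w B(1) aa st unfolding S_def by auto
      moreover have "x \<notin> levels_upto z m" using calculation levels_upto_notin s(1,4) p(1) by blast
      \<comment> \<open>A neighbour i of t on the lower path would be adjacent to p, s or q; but t
        is far from p and q, and y and y' have no common neighbour.\<close>
      moreover have "\<not> E t i" using near i s nst[of i] unfolding far_def by blast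
      ultimately show ?thesis using i IJN(5) by blast
    qed
    have "1 \<le> length P" using P(2) by (cases P) auto
    then have "2 * l \<le> length ?M" using R(3) l_ge by simp
    from closing_parity[OF M _ _ IJN(1) s(2) this dis] have "even (length ?M + length I)" using P(2,3) by simp
    then show ?thesis using oI by simp
  qed
  have Rne: "R \<noteq> []" using R(3) by auto
  \<comment> \<open>The successor of w lies outside B, hence has no neighbour in S; so w is neither
    a nor a'.\<close>
  then have "E w (hd R)" using R(1) by (simp add: ipath.simps)
  moreover have "hd R \<notin> B" "hd R \<in> K" using R(2) hd_in_set[OF Rne] by blast+
  ultimately have wS: "w \<noteq> a" "w \<noteq> a'" unfolding B_def S_def by blast+
  have wy: "w \<noteq> y" "w \<noteq> y'" using w B(1) KL pK y y' by blast+
  \<comment> \<open>By symmetry it suffices to treat a neighbour s or b of w. Two legs of different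
    parity are exhibited: \<open>[s]\<close> against one of \<open>[t, b']\<close>,
    \<open>[t, s]\<close>, \<open>[t, b', b, s]\<close>, or \<open>[s, b]\<close> against
    \<open>[t, b', b]\<close>.\<close>
  have contra: False
    if st: "(s = y \<and> t = y' \<and> b = a \<and> b' = a') \<or> (s = y' \<and> t = y \<and> b = a' \<and> b' = a)"
      and near: "E s w \<or> \<not> E y w \<and> \<not> E y' w \<and> E b w" for s t b b'
  proof -
    have e: "E s b" "E b b'" "E b' t" using st y y' aa sym by blast+
    have d: "w \<noteq> s" "w \<noteq> b" "w \<noteq> b'" "w \<noteq> t" using st wS wy by auto
    have S: "{s, b, b', t} = S" using st by (auto simp: S_def)
    have n1: "\<not> E s b'" "\<not> E b t" using tri[OF e(1,2)] tri[OF e(2,3)] by auto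
    then have n2: "\<not> E b' s" "\<not> E t b" using sym by blast+
    have "y \<notin> K" "y' \<notin> K" using pK y(1) y'(1) KL by blast+
    then have n3: "s \<noteq> b'" "s \<noteq> b" "t \<noteq> b" "t \<noteq> b'" using st aa by auto
    have n4: "s \<noteq> t" "b \<noteq> b'" using n1(2) n2(2) e(1,2) irrefl sym by blast+
    note n = n1 n2 n3 n4
    have st1: "(s = y \<and> t = y' \<and> b = a) \<or> (s = y' \<and> t = y \<and> b = a')"
      and st2: "(t = y \<and> s = y' \<and> b' = a) \<or> (t = y' \<and> s = y \<and> b' = a')" using st by auto
    note leg1 = leg[OF st1] and leg2 = leg[OF st2]
    show False
    proof (cases "E s w")
      case True
      have nw: "\<not> E b w" "\<not> E t w" using True e tri sym nc[of w] st by blast+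
      have 1: "odd (length [s] + length R)"
        by (rule leg1) (use True d S in \<open>auto simp: ipath.simps\<close>)
      consider "E b' w" | "\<not> E b' w" "E t s" | "\<not> E b' w" "\<not> E t s" by blast
      then show False
      proof cases
        case 1
        have "odd (length [t, b'] + length R)"
          by (rule leg2) (use 1 d S nw n sym[OF e(3)] in \<open>auto simp: ipath.simps\<close>)
        then show False using \<open>odd (length [s] + length R)\<close> by simp
      next
        case 2
        have "odd (length [t, s] + length R)"
          by (rule leg2) (use 2 d S nw n True in \<open>auto simp: ipath.simps\<close>)
        then show False using \<open>odd (length [s] + length R)\<close> by simp
      next
        case 3
        have "odd (length [t, b', b, s] + length R)"
          by (rule leg2) (use 3 d S nw n True sym[OF e(1)] sym[OF e(2)] sym[OF e(3)] in \<open>auto simp: ipath.simps\<close>)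
        then show False using \<open>odd (length [s] + length R)\<close> by simp
      qed
    next
      case False
      then have nw: "\<not> E s w" "\<not> E t w" "E b w" using near st by auto
      then have "\<not> E b' w" using e tri sym by blast
      have "odd (length [s, b] + length R)"
        by (rule leg1) (use nw d S n e in \<open>auto simp: ipath.simps\<close>)
      moreover have "odd (length [t, b', b] + length R)"
        by (rule leg2) (use nw \<open>\<not> E b' w\<close> d S n sym[OF e(2)] sym[OF e(3)] in \<open>auto simp: ipath.simps\<close>)
      ultimately show False by simp
    qed
  qed
  have "E y w \<or> E y' w \<or> E a w \<or> E a' w" using w unfolding B_def S_def by blast
  then show False using contra[of y y' a a'] contra[of y' y a' a] by blast
qed

section \<open>Colouring the levels and the whole graph\<close>

lemma colorable_level: "colorable (level z k) (6 * l + 4)"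
proof (cases "k \<le> 3")
  case True
  then have "colorable (level z k) 1" by (intro colorable_stable level_stable)
  then show ?thesis by (rule colorable_mono) auto
next
  case False
  \<comment> \<open>The component lies in level m + 2, the parents in level m + 1, and the return
    paths in the levels up to m.\<close>
  define m where "m = k - 2"
  have k: "k = Suc (Suc m)" using False by (simp add: m_def)
  show ?thesis
  proof (rule colorable_components[of _ "level z k"])
    fix x assume "x \<in> level z k"
    define pa where "pa = (\<lambda>v. SOME p. p \<in> level z (Suc m) \<and> E v p)"
    have pa: "pa v \<in> level z (Suc m) \<and> E v (pa v)" if v: "v \<in> level z (Suc (Suc m))" for v
    proof -
      obtain p where "p \<in> level z (Suc m)" "E p v" by (rule level_parent[OF v])
      then have "\<exists>p. p \<in> level z (Suc m) \<and> E v p" using sym by blast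
      then show ?thesis unfolding pa_def by (rule someI_ex)
    qed
    have sub: "component (level z k) x \<subseteq> level z (Suc (Suc m))" using component_subset k by blast
    have "colorable (component (level z k) x) (6 * l + 4)"
    proof (rule ccontr)
      assume nc: "\<not> colorable (component (level z k) x) (6 * l + 4)"
      have pa': "pa v \<in> level z (Suc m) \<and> E v (pa v)" if "v \<in> component (level z k) x" for v using pa sub that by blast
      obtain q A e where q: "q \<in> level z (Suc m)" and A: "A \<subseteq> component (level z k) x" "\<not> colorable A (2 * l + 2)"
        and f: "\<forall>v\<in>A. far q (pa v)"
        and e: "\<forall>v\<in>A. \<forall>I. ipath (pa v # I @ [q]) \<longrightarrow> set I \<subseteq> levels_upto z m \<longrightarrow> even (length I) = e"
        by (rule uniform_parity_exists[OF sub connected_set_component nc pa'])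
      have paA: "pa v \<in> level z (Suc m) \<and> E v (pa v)" if "v \<in> A" for v using pa' A(1) that by blast
      show False
        by (rule uniform_parity_contradiction[OF subset_trans[OF A(1) sub] A(2) paA q bspec[OF f] e[rule_format]])
    qed
    then show "colorable (component (level z k) x \<inter> level z k) (6 * l + 4)" by (rule colorable_mono) auto
  qed simp
qed

lemma ipath_in_ball: "ipath_in UNIV v z xs \<Longrightarrow> \<exists>n. v \<in> ball n z"
proof (induction xs arbitrary: v)
  case (Cons a xs)
  show ?case
  proof (cases "xs = []")
    case True
    then have "v = z" using Cons.prems by (auto simp: ipath_in_def)
    then show ?thesis by (intro exI[of _ 0]) simp
  next
    case False
    then have "ipath_in UNIV (hd xs) z xs" "E v (hd xs)" using Cons.prems by (auto simp: ipath_in_def ipath.simps)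
    then show ?thesis using Cons.IH ball_adj sym by blast
  qed
qed (simp add: ipath_in_def)

lemma colorable_UNIV: "colorable UNIV (12 * l + 8)"
proof (rule colorable_components[of _ UNIV])
  fix z
  let ?k = "6 * l + 4"
  define c where "c = (\<lambda>i. SOME c. (\<forall>v\<in>level z i. c v < ?k) \<and> (\<forall>u\<in>level z i. \<forall>v\<in>level z i. E u v \<longrightarrow> c u \<noteq> (c v :: nat)))"
  have c: "(\<forall>v\<in>level z i. c i v < ?k) \<and> (\<forall>u\<in>level z i. \<forall>v\<in>level z i. E u v \<longrightarrow> c i u \<noteq> c i v)" for i
    using someI_ex[OF colorable_level[of z i, unfolded colorable_def]] unfolding c_def .
  have c1: "c i v < ?k" if "v \<in> level z i" for i v using c that by blast
  have c2: "c i u \<noteq> c i v" if "u \<in> level z i" "v \<in> level z i" "E u v" for i u v using c that by blast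
  \<comment> \<open>Odd levels use a second palette, shifted by 6l + 4. Adjacent vertices lie in the
    same level or in consecutive ones.\<close>
  define f where "f = (\<lambda>v. c (depth z v) v + (if odd (depth z v) then ?k else 0))"
  have lv: "v \<in> level z (depth z v)" if v: "v \<in> component UNIV z" for v
  proof -
    obtain xs where "ipath_in UNIV z v xs" using v by (auto simp: component_def)
    from ipath_in_ball[OF ipath_in_sym[OF this]] obtain n where "v \<in> ball n z" ..
    then show ?thesis by (rule level_depth)
  qed
  have "f v < 12 * l + 8" if "v \<in> component UNIV z" for v
  proof -
    have "c (depth z v) v < ?k" by (rule c1[OF lv[OF that]])
    then show ?thesis by (simp add: f_def)
  qed
  moreover have "f u \<noteq> f v" if u: "u \<in> component UNIV z" and v: "v \<in> component UNIV z" and e: "E u v" for u v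
  proof -
    have cu: "c (depth z u) u < ?k" "c (depth z v) v < ?k" using c1[OF lv[OF u]] c1[OF lv[OF v]] .
    have d: "depth z u \<le> Suc (depth z v)" "depth z v \<le> Suc (depth z u)" using level_adj[OF lv[OF u] lv[OF v] e] by auto
    show ?thesis
    proof (cases "depth z u = depth z v")
      case True
      then have "c (depth z u) u \<noteq> c (depth z u) v" using c2[OF lv[OF u] _ e] lv[OF v] by simp
      then show ?thesis using True by (simp add: f_def)
    next
      case False
      then have "depth z u = Suc (depth z v) \<or> depth z v = Suc (depth z u)" using d by linarith
      then have "odd (depth z u) \<noteq> odd (depth z v)" by auto
      then show ?thesis using cu unfolding f_def by auto
    qed
  qed
  ultimately show "colorable (component UNIV z \<inter> UNIV) (12 * l + 8)"
    unfolding colorable_def by (intro exI[of _ f]) simp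
qed simp

end

section \<open>Holes as arc cycles\<close>

text \<open>One arc is picked for each adjacent pair. The equation with \<open>zip\<close> keeps
  track of the end pairs, from which inducedness of an arc cycle can be read off.\<close>

lemma (in wf_digraph) walk_along_vertices:
  assumes "u \<in> verts G" "successively (\<lambda>x y. x \<rightarrow>\<^bsub>G\<^esub> y) (u # ys)"
  shows "\<exists>p. awalk u p (last (u # ys)) \<and> awalk_verts u p = u # ys \<and>
    map (arc_to_ends G) p = zip (u # ys) ys"
  using assms
proof (induction ys arbitrary: u)
  case Nil
  then show ?case by (intro exI[of _ "[]"]) (simp add: awalk_def)
next
  case (Cons y ys)
  obtain e where e: "e \<in> arcs G" "tail G e = u" "head G e = y" using Cons.prems(2) by auto
  have "y \<in> verts G" using e head_in_verts by blast
  then obtain p where "awalk y p (last (y # ys))" "awalk_verts y p = y # ys"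
    "map (arc_to_ends G) p = zip (y # ys) ys" using Cons.IH Cons.prems(2) by auto
  moreover have "arc_to_ends G e = (u, y)" using e by (simp add: arc_to_ends_def)
  ultimately show ?case using e Cons.prems(1)
    by (intro exI[of _ "e # p"]) (auto simp: awalk_def)
qed

text \<open>The two ends carry different names because the induction changes only a; the application
  sets both to the same vertex.\<close>

lemma zip_closed_walk:
  "(a, hd (xs @ [b])) \<in> set (zip (a # xs @ [b]) (xs @ [b])) \<and>
   (last (a # xs), b) \<in> set (zip (a # xs @ [b]) (xs @ [b])) \<and>
   set (zip xs (tl xs)) \<subseteq> set (zip (a # xs @ [b]) (xs @ [b]))"
proof (induction xs arbitrary: a)
  case (Cons c xs)
  have "set (zip (c # xs) xs) \<subseteq> insert (c, hd (xs @ [b])) (set (zip xs (tl xs)))" by (cases xs) auto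
  then show ?case using Cons[of c] by auto
qed simp

context sgraph
begin

lemma successively_ipath: "ipath xs \<Longrightarrow> successively E xs"
proof (induction xs)
  case (Cons x xs)
  then show ?case by (cases xs) (auto simp: ipath.simps)
qed simp

lemma ipath_adj_zip: "ipath xs \<Longrightarrow> t \<in> set xs \<Longrightarrow> h \<in> set xs \<Longrightarrow> E t h \<Longrightarrow>
    (t, h) \<in> set (zip xs (tl xs)) \<or> (h, t) \<in> set (zip xs (tl xs))"
proof (induction xs)
  case (Cons x xs)
  show ?case
  proof (cases "xs = []")
    case True
    then show ?thesis using Cons.prems irrefl by auto
  next
    case False
    then have z: "set (zip (x # xs) xs) = insert (x, hd xs) (set (zip xs (tl xs)))" by (cases xs) auto
    have p: "ipath xs" "\<forall>y\<in>set xs. E x y \<longrightarrow> y = hd xs" using Cons.prems(1) False by (auto simp: ipath.simps)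
    consider "t \<in> set xs" "h \<in> set xs" | "t = x" "h \<in> set xs" | "t \<in> set xs" "h = x" | "t = x" "h = x"
      using Cons.prems by auto
    then show ?thesis
    proof cases
      case 1
      then show ?thesis using Cons.IH p(1) Cons.prems(4) z by auto
    next
      case 2
      then show ?thesis using p(2) Cons.prems(4) z by auto
    next
      case 3
      then show ?thesis using p(2) sym[OF Cons.prems(4)] z by auto
    next
      case 4
      then show ?thesis using Cons.prems(4) irrefl by blast
    qed
  qed
qed simp

lemma ipath_distinct: "ipath xs \<Longrightarrow> distinct xs"
  by (induction xs) (auto simp: ipath.simps)

end

context graph
begin

sublocale sgraph "\<lambda>u v. u \<rightarrow>\<^bsub>G\<^esub> v"
proof
  show "v \<rightarrow>\<^bsub>G\<^esub> u" if "u \<rightarrow>\<^bsub>G\<^esub> v" for u v using arcs_ends_symmetric[OF sym_arcs that] .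
  show "\<not> u \<rightarrow>\<^bsub>G\<^esub> u" for u by (rule notI) (rule adj_not_same)
qed

text \<open>Arcs are picked along the closed vertex list v, Q, v. An arc of the graph between two of
  its vertices either meets v, and then leads to an end of Q, or joins two vertices of the induced
  path Q, which are then consecutive.\<close>

lemma has_hole_icycle:
  assumes "icycle xs" shows "has_hole G (length xs)"
proof -
  obtain v Q where xs: "xs = v # Q" using assms by (cases xs) (auto simp: icycle_def)
  have Q: "ipath Q" "v \<notin> set Q" "4 \<le> length xs" "\<forall>x\<in>set Q. v \<rightarrow>\<^bsub>G\<^esub> x \<longleftrightarrow> x = hd Q \<or> x = last Q"
    using assms xs by (auto simp: icycle_def)
  have ne: "Q \<noteq> []" using Q(1) by auto
  have ends: "v \<rightarrow>\<^bsub>G\<^esub> hd Q" "last Q \<rightarrow>\<^bsub>G\<^esub> v" using Q(4) ne sym by auto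
  have "successively (\<lambda>x y. x \<rightarrow>\<^bsub>G\<^esub> y) (v # Q)"
    using successively_ipath[OF Q(1)] ne ends(1) by (cases Q) auto
  then have "successively (\<lambda>x y. x \<rightarrow>\<^bsub>G\<^esub> y) (v # Q @ [v])"
    using successively_append_iff[of _ "v # Q" "[v]"] ne ends(2) by simp
  moreover have "v \<in> verts G" using adj_in_verts ends by blast
  ultimately obtain p where p: "awalk v p (last (v # Q @ [v]))" "awalk_verts v p = v # Q @ [v]"
    "map (arc_to_ends G) p = zip (v # Q @ [v]) (Q @ [v])" using walk_along_vertices by blast
  have len: "length p = length xs" using arg_cong[OF p(3), of length] xs by simp
  have "map (tail G) p = map fst (map (arc_to_ends G) p)" by (simp add: arc_to_ends_def)
  also have "\<dots> = v # Q" unfolding p(3) by (simp add: map_fst_zip_take)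
  finally have tails: "tail G ` set p = insert v (set Q)" by (metis list.set_map list.simps(15))
  have "cycle p" unfolding cycle_def
    using p(1,2) Q(2) ipath_distinct[OF Q(1)] len xs by (intro exI[of _ v]) auto
  moreover have "\<exists>b\<in>set p. arc_to_ends G b = (tail G a, head G a) \<or> arc_to_ends G b = (head G a, tail G a)"
    if a: "a \<in> arcs G" and m: "tail G a \<in> tail G ` set p" "head G a \<in> tail G ` set p" for a
  proof -
    let ?t = "tail G a" and ?h = "head G a"
    let ?Z = "set (zip (v # Q @ [v]) (Q @ [v]))"
    have th: "?t \<rightarrow>\<^bsub>G\<^esub> ?h" using a by (auto simp: arcs_ends_conv)
    have Z: "(v, hd Q) \<in> ?Z" "(last Q, v) \<in> ?Z" "set (zip Q (tl Q)) \<subseteq> ?Z"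
      using zip_closed_walk[of v Q v] ne by auto
    have "(?t, ?h) \<in> ?Z \<or> (?h, ?t) \<in> ?Z"
    proof -
      consider "?t = v" "?h = v" | "?t = v" "?h \<in> set Q" | "?t \<in> set Q" "?h = v" | "?t \<in> set Q" "?h \<in> set Q"
        using m tails by auto
      then show ?thesis
      proof cases
        case 1
        then show ?thesis using th irrefl by metis
      next
        case 2
        then show ?thesis using th Q(4) Z by metis
      next
        case 3
        then show ?thesis using sym[OF th] Q(4) Z by metis
      next
        case 4
        then show ?thesis using ipath_adj_zip[OF Q(1) 4 th] Z(3) by blast
      qed
    qed
    moreover have "?Z = arc_to_ends G ` set p" unfolding p(3)[symmetric] by simp
    ultimately show ?thesis by (metis imageE)
  qed
  ultimately have "hole G p" unfolding hole_def using Q(3) len by simp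
  then show ?thesis unfolding has_hole_def using len by blast
qed

end

theorem theorem1p2:
  fixes G :: "('a, 'b) pre_digraph" and l :: nat
  assumes "l \<ge> 2"
    and "graph G"
    and "triangle_free G"
    and "\<not> has_hole G 5"
    and "\<not> has_hole G 7"
    and "\<forall>k. odd k \<and> k \<ge> 2 * l + 3 \<longrightarrow> \<not> has_hole G k"
  shows "chromatic_number G \<le> 12 * l + 8"
proof -
  interpret graph G by (rule assms(2))
  interpret hole_restricted "\<lambda>u v. u \<rightarrow>\<^bsub>G\<^esub> v" l
  proof unfold_locales
    fix u v w assume "u \<rightarrow>\<^bsub>G\<^esub> v" "v \<rightarrow>\<^bsub>G\<^esub> w"
    then show "\<not> u \<rightarrow>\<^bsub>G\<^esub> w" using assms(3) sym unfolding triangle_free_def by blast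
  next
    fix xs assume c: "icycle xs"
    note h = has_hole_icycle[OF c]
    show "length xs \<noteq> 5" "length xs \<noteq> 7" using h assms(4,5) by auto
    show "length xs < 2 * l + 3" if "odd (length xs)" using h assms(6) that not_le by blast
  qed (rule assms(1))
  obtain c where c: "\<forall>v. c v < 12 * l + 8" "\<forall>u v. u \<rightarrow>\<^bsub>G\<^esub> v \<longrightarrow> c u \<noteq> c v"
    using colorable_UNIV unfolding colorable_def by auto
  have "proper_coloring G (12 * l + 8) c" unfolding proper_coloring_def using c by auto
  then show ?thesis unfolding chromatic_number_def by (intro Least_le exI)
qed

end
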